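(* Let $\lambda/\mu$ be a border strip and let $T$ be an SSYT of shape $\lambda/\mu$, viewed as a reverse plane partition of shape $\lambda$ with zero entries on $[\mu]$. Then $HG(T)\in\mathcal{A}^*_D$ for some excited diagram $D\in\mathcal{E}(\lambda/\mu)$.
   Context: $[\lambda]=\{(i,j):1\le i\le\ell(\lambda),1\le j\le\lambda_i\}$ (English convention). A border strip is a connected skew shape $[\lambda/\mu]=[\lambda]\setminus[\mu]$ containing no $2\times2$ square. An SSYT of shape $\lambda/\mu$ is a filling of $[\lambda/\mu]$ by nonnegative integers weakly increasing in rows and strictly increasing down columns; a reverse plane partition of shape $\lambda$ is a filling of $[\lambda]$ by nonnegative integers weakly increasing in rows and columns. Hillman–Grassl map: for such $\pi$, start with the zero array $A$ of shape $\lambda$. While $\pi\ne0$: let $b$ be the leftmost column with a nonzero entry and $a$ the lowest row with $\pi(a,b)\neq0$; build a path from $(a,b)$: at $(x,y)$, if $(x-1,y)\in[\lambda]$ and $\pi(x-1,y)=\pi(x,y)$ move to $(x-1,y)$, otherwise if $(x,y+1)\in[\lambda]$ move to $(x,y+1)$, otherwise stop; if the path ends in row $r$, subtract $1$ from each entry on the path and add $1$ to $A(r,b)$. $HG(\pi)$ is the final array. Excited diagrams: for $D\subseteq[\lambda]$, $(i,j)\in D$ is active if $(i+1,j),(i,j+1),(i+1,j+1)\in[\lambda]\setminus D$; an excited move replaces it by $(i+1,j+1)$. $\mathcal{E}(\lambda/\mu)$ is the set of subsets obtained from $[\mu]$ by finite sequences of excited moves. Broken diagonals: the Kreiman strips $\gamma_1,\dots,\gamma_k$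 are the connected components, ordered by decreasing content $j-i$ of their NE-most cell, of the sets $K_\varepsilon=\{(i,j)\in[\lambda/\mu]:(i-\varepsilon,j-\varepsilon)\in[\lambda/\mu],(i-\varepsilon-1,j-\varepsilon-1)\notin[\lambda/\mu]\}$, $\varepsilon\ge0$; each is a lattice path (sequence of cells with north steps $(i,j)\to(i-1,j)$ and east steps $(i,j)\to(i,j+1)$) from its SW-most to its NE-most cell. For $D\in\mathcal{E}(\lambda/\mu)$ there is a unique $k$-tuple of pairwise disjoint lattice paths $(\gamma_1(D),\dots,\gamma_k(D))$ in $[\lambda]$, $\gamma_i(D)$ with the same endpoints as $\gamma_i$, with union $[\lambda]\setminus D$; $\mathrm{Br}(D)$ is the set of cells of these paths whose successor lies directly north. $\mathcal{A}^*_D$ is the set of arrays $A$ of nonnegative integers of shape $\lambda$ with support contained in $[\lambda]\setminus D$ and with $A(u)>0$ for every $u\in\mathrm{Br}(D)$. *)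

theory Defs
  imports Main "HOL-Library.While_Combinator"
begin

type_synonym cell = "int \<times> int"

section \<open>Partitions and skew shapes\<close>

definition is_partition :: "nat list \<Rightarrow> bool" where
  "is_partition lam \<longleftrightarrow> sorted_wrt (\<ge>) lam \<and> (\<forall>p \<in> set lam. p > 0)"

text \<open>Cells are (row, column) in matrix coordinates, starting at (1, 1).\<close>

definition diagram :: "nat list \<Rightarrow> cell set" where
  "diagram lam = {(i, j). 1 \<le> i \<and> i \<le> int (length lam) \<and> 1 \<le> j \<and> j \<le> int (lam ! nat (i - 1))}"

definition skew_shape :: "nat list \<Rightarrow> nat list \<Rightarrow> bool" where
  "skew_shape lam mu \<longleftrightarrow> is_partition lam \<and> is_partition mu \<and> diagram mu \<subseteq> diagram lam"

definition skew_diagram :: "nat list \<Rightarrow> nat list \<Rightarrow> cell set" where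
  "skew_diagram lam mu = diagram lam - diagram mu"

definition cell_adj :: "cell set \<Rightarrow> (cell \<times> cell) set" where
  "cell_adj S = {((i, j), (i', j')). (i, j) \<in> S \<and> (i', j') \<in> S \<and> \<bar>i - i'\<bar> + \<bar>j - j'\<bar> = 1}"

definition cells_connected :: "cell set \<Rightarrow> bool" where
  "cells_connected S \<longleftrightarrow> (\<forall>u \<in> S. \<forall>v \<in> S. (u, v) \<in> (cell_adj S)\<^sup>*)"

definition cell_components :: "cell set \<Rightarrow> cell set set" where
  "cell_components S = S // (cell_adj S)\<^sup>*"

definition border_strip :: "nat list \<Rightarrow> nat list \<Rightarrow> bool" where
  "border_strip lam mu \<longleftrightarrow>
     skew_shape lam mu \<and>
     cells_connected (skew_diagram lam mu) \<and>
     \<not> (\<exists>i j. {(i, j), (i, j + 1), (i + 1, j), (i + 1, j + 1)} \<subseteq> skew_diagram lam mu)"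

section \<open>Fillings\<close>

text \<open>A filling of a set of cells is a total function of which only the values on that set matter.\<close>

definition is_ssyt :: "nat list \<Rightarrow> nat list \<Rightarrow> (cell \<Rightarrow> nat) \<Rightarrow> bool" where
  "is_ssyt lam mu T \<longleftrightarrow>
     (\<forall>i j j'. (i, j) \<in> skew_diagram lam mu \<and> (i, j') \<in> skew_diagram lam mu \<and> j < j'
        \<longrightarrow> T (i, j) \<le> T (i, j')) \<and>
     (\<forall>i i' j. (i, j) \<in> skew_diagram lam mu \<and> (i', j) \<in> skew_diagram lam mu \<and> i < i'
        \<longrightarrow> T (i, j) < T (i', j))"

definition extend_by_zero :: "cell set \<Rightarrow> (cell \<Rightarrow> nat) \<Rightarrow> cell \<Rightarrow> nat" where
  "extend_by_zero S T = (\<lambda>u. if u \<in> S then T u else 0)"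

section \<open>The Hillman--Grassl map\<close>

function hg_path :: "nat list \<Rightarrow> (cell \<Rightarrow> nat) \<Rightarrow> int \<Rightarrow> int \<Rightarrow> cell list" where
  "hg_path lam \<pi> x y =
     (x, y) #
       (if (x - 1, y) \<in> diagram lam \<and> \<pi> (x - 1, y) = \<pi> (x, y) then hg_path lam \<pi> (x - 1) y
        else if (x, y + 1) \<in> diagram lam then hg_path lam \<pi> x (y + 1)
        else [])"
  by pat_completeness auto

lemma diagram_col_le_sum_list:
  assumes "(i, j) \<in> diagram lam"
  shows "j \<le> int (sum_list lam)"
proof -
  have "nat (i - 1) < length lam" and "j \<le> int (lam ! nat (i - 1))"
    using assms by (auto simp: diagram_def)
  then show ?thesis
    using elem_le_sum_list[of "nat (i - 1)" lam] by linarith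
qed

termination
proof (relation "measure (\<lambda>(lam, \<pi>, x, y). nat x + nat (int (sum_list lam) - y))", goal_cases)
  case (2 lam \<pi> x y)
  then show ?case by (auto simp: diagram_def)
next
  case (3 lam \<pi> x y)
  then show ?case using diagram_col_le_sum_list[of x "y + 1" lam] by auto
qed simp

declare hg_path.simps [simp del]

text \<open>In matrix coordinates the lowest row is the one with the largest index.\<close>

definition hg_start_col :: "nat list \<Rightarrow> (cell \<Rightarrow> nat) \<Rightarrow> int" where
  "hg_start_col lam \<pi> = Min {b. \<exists>a. (a, b) \<in> diagram lam \<and> \<pi> (a, b) \<noteq> 0}"

definition hg_start_row :: "nat list \<Rightarrow> (cell \<Rightarrow> nat) \<Rightarrow> int" where
  "hg_start_row lam \<pi> =
     Max {a. (a, hg_start_col lam \<pi>) \<in> diagram lam \<and> \<pi> (a, hg_start_col lam \<pi>) \<noteq> 0}"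

definition hg_step :: "nat list \<Rightarrow> (cell \<Rightarrow> nat) \<times> (cell \<Rightarrow> nat) \<Rightarrow> (cell \<Rightarrow> nat) \<times> (cell \<Rightarrow> nat)" where
  "hg_step lam = (\<lambda>(\<pi>, A).
     let b = hg_start_col lam \<pi>;
         p = hg_path lam \<pi> (hg_start_row lam \<pi>) b;
         r = fst (last p)
     in ((\<lambda>u. if u \<in> set p then \<pi> u - 1 else \<pi> u), A((r, b) := A (r, b) + 1)))"

definition HG :: "nat list \<Rightarrow> (cell \<Rightarrow> nat) \<Rightarrow> cell \<Rightarrow> nat" where
  "HG lam \<pi> =
     snd (while (\<lambda>(\<pi>, A). \<exists>u \<in> diagram lam. \<pi> u \<noteq> 0) (hg_step lam) (\<pi>, \<lambda>_. 0))"

section \<open>Excited diagrams\<close>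

definition active_cell :: "nat list \<Rightarrow> cell set \<Rightarrow> int \<Rightarrow> int \<Rightarrow> bool" where
  "active_cell lam D i j \<longleftrightarrow>
     (i, j) \<in> D \<and> {(i + 1, j), (i, j + 1), (i + 1, j + 1)} \<subseteq> diagram lam - D"

inductive_set excited_diagrams :: "nat list \<Rightarrow> nat list \<Rightarrow> cell set set"
  for lam mu :: "nat list" where
  base: "diagram mu \<in> excited_diagrams lam mu"
| move: "D \<in> excited_diagrams lam mu \<Longrightarrow> active_cell lam D i j
    \<Longrightarrow> insert (i + 1, j + 1) (D - {(i, j)}) \<in> excited_diagrams lam mu"

section \<open>Kreiman strips and broken diagonals\<close>

definition content :: "cell \<Rightarrow> int" where
  "content u = snd u - fst u"

definition kreiman_level :: "nat list \<Rightarrow> nat list \<Rightarrow> nat \<Rightarrow> cell set" where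
  "kreiman_level lam mu \<epsilon> =
     {(i, j) \<in> skew_diagram lam mu.
        (i - int \<epsilon>, j - int \<epsilon>) \<in> skew_diagram lam mu \<and>
        (i - int \<epsilon> - 1, j - int \<epsilon> - 1) \<notin> skew_diagram lam mu}"

definition ne_most :: "cell set \<Rightarrow> cell" where
  "ne_most S = (THE u. u \<in> S \<and> (\<forall>v \<in> S. fst u \<le> fst v \<and> snd v \<le> snd u))"

definition sw_most :: "cell set \<Rightarrow> cell" where
  "sw_most S = (THE u. u \<in> S \<and> (\<forall>v \<in> S. fst v \<le> fst u \<and> snd u \<le> snd v))"

text \<open>
  Distinct strips have NE-most cells of distinct content, so the sorting key is injective
  on the set of strips.
\<close>

definition kreiman_strips :: "nat list \<Rightarrow> nat list \<Rightarrow> cell set list" where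
  "kreiman_strips lam mu =
     sorted_key_list_of_set (\<lambda>S. - content (ne_most S))
       (\<Union>\<epsilon>. cell_components (kreiman_level lam mu \<epsilon>))"

definition north_step :: "cell \<Rightarrow> cell \<Rightarrow> bool" where
  "north_step u v \<longleftrightarrow> v = (fst u - 1, snd u)"

definition east_step :: "cell \<Rightarrow> cell \<Rightarrow> bool" where
  "east_step u v \<longleftrightarrow> v = (fst u, snd u + 1)"

definition lattice_path :: "cell list \<Rightarrow> bool" where
  "lattice_path p \<longleftrightarrow> p \<noteq> [] \<and> successively (\<lambda>u v. north_step u v \<or> east_step u v) p"

definition kreiman_path_tuple :: "nat list \<Rightarrow> nat list \<Rightarrow> cell set \<Rightarrow> cell list list \<Rightarrow> bool" where
  "kreiman_path_tuple lam mu D ps \<longleftrightarrow>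
     list_all2 (\<lambda>\<gamma> p. lattice_path p \<and> set p \<subseteq> diagram lam \<and>
                       hd p = sw_most \<gamma> \<and> last p = ne_most \<gamma>)
       (kreiman_strips lam mu) ps \<and>
     (\<forall>m < length ps. \<forall>n < length ps. m \<noteq> n \<longrightarrow> set (ps ! m) \<inter> set (ps ! n) = {}) \<and>
     (\<Union>p \<in> set ps. set p) = diagram lam - D"

text \<open>The tuple of paths is unique for every excited diagram \<open>D\<close>.\<close>

definition kreiman_paths :: "nat list \<Rightarrow> nat list \<Rightarrow> cell set \<Rightarrow> cell list list" where
  "kreiman_paths lam mu D = (THE ps. kreiman_path_tuple lam mu D ps)"

definition broken_diagonals :: "nat list \<Rightarrow> nat list \<Rightarrow> cell set \<Rightarrow> cell set" where
  "broken_diagonals lam mu D =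
     {p ! n | p n. p \<in> set (kreiman_paths lam mu D) \<and> Suc n < length p \<and>
                   north_step (p ! n) (p ! Suc n)}"

definition array_star :: "nat list \<Rightarrow> nat list \<Rightarrow> cell set \<Rightarrow> (cell \<Rightarrow> nat) set" where
  "array_star lam mu D =
     {A. {u. A u \<noteq> 0} \<subseteq> diagram lam - D \<and> (\<forall>u \<in> broken_diagonals lam mu D. A u > 0)}"

end

theory Submission
  imports Defs
begin

text \<open>
  A border strip has exactly one cell of each content, so it is a single lattice path from its
  SW-most to its NE-most cell. On a filling supported on the strip every Hillman--Grassl path is a
  segment of the strip: it starts at the first nonzero cell \<open>s\<close> and stops at the first cell \<open>e\<close> with
  a strict descent to its northern neighbour, or at the NE end. The step adds 1 to the entry in the row of \<open>e\<close>
  and the column of \<open>s\<close> and lowers the descent at \<open>e\<close> by 1, leaving the descents elsewhere unchanged.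
  Hence \<open>s\<close> and \<open>e\<close> only move NE, and the support of the final array is a chain. Since columns are
  strict, every row of the strip except the top one contains a nonzero entry. The lattice path that
  leaves each row northwards at its last nonzero entry contains the support, and its complement is
  an excited diagram: pushing the path SE one corner at a time leads back to the strip.
\<close>

section \<open>Young diagrams as finite down-sets, and convexity of skew shapes\<close>

lemma diagram_down_closed:
  assumes "is_partition lam" "(i, j) \<in> diagram lam" "1 \<le> i'" "i' \<le> i" "1 \<le> j'" "j' \<le> j"
  shows "(i', j') \<in> diagram lam"
proof -
  have "lam ! nat (i - 1) \<le> lam ! nat (i' - 1)"
  proof (cases "i' = i")
    case False
    then show ?thesis
      using assms sorted_wrt_nth_less[of "(\<ge>)" lam "nat (i' - 1)" "nat (i - 1)"]
      by (auto simp: is_partition_def diagram_def)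
  qed simp
  then show ?thesis using assms by (auto simp: diagram_def)
qed

lemma finite_diagram: "finite (diagram lam)"
proof (rule finite_subset)
  show "diagram lam \<subseteq> {1..int (length lam)} \<times> {1..int (sum_list lam)}"
    using diagram_col_le_sum_list by (fastforce simp: diagram_def)
qed simp

text \<open>Down-closure of \<open>lam\<close> puts the cell into \<open>lam\<close>; down-closure
  of \<open>mu\<close> keeps it out of \<open>mu\<close>, since otherwise \<open>(i, j)\<close>
  would lie in \<open>mu\<close> too.\<close>

lemma skew_diagram_convex:
  assumes "skew_shape lam mu" "(i, j) \<in> skew_diagram lam mu" "(i', j') \<in> diagram lam"
    and "i \<le> x" "x \<le> i'" "j \<le> y" "y \<le> j'"
  shows "(x, y) \<in> skew_diagram lam mu"
proof -
  have pos: "1 \<le> i" "1 \<le> j"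
    using assms(2) by (auto simp: skew_diagram_def diagram_def)
  have "(x, y) \<in> diagram lam"
    using assms pos diagram_down_closed[of lam i' j' x y] by (auto simp: skew_shape_def)
  moreover have "(x, y) \<notin> diagram mu"
    using assms pos diagram_down_closed[of mu x y i j]
    by (auto simp: skew_shape_def skew_diagram_def)
  ultimately show ?thesis by (simp add: skew_diagram_def)
qed

text \<open>Insertions with equal keys need not commute and the key is arbitrary. On at most one
  element commutation is trivial, so the fold is interpreted on just that set, here and for the
  singleton below.\<close>

lemma sorted_key_list_of_empty_set: "sorted_key_list_of_set f {} = []"
proof -
  interpret folding_on "{}" "insort_key f" "[]" by unfold_locales simp
  show ?thesis by (simp add: sorted_key_list_of_set_def)
qed

lemma sorted_key_list_of_set_singleton: "sorted_key_list_of_set f {x} = [x]"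
proof -
  interpret folding_on "{x}" "insort_key f" "[]" by unfold_locales simp
  show ?thesis by (simp add: sorted_key_list_of_set_def)
qed

section \<open>Lattice paths\<close>

text \<open>Both kinds of step raise the content by 1.\<close>

lemma lattice_path_sorted_content:
  assumes "lattice_path p"
  shows "sorted_wrt (<) (map content p)"
proof -
  have "successively (\<lambda>u v. content u < content v) p"
    using assms unfolding lattice_path_def
    by (auto elim!: successively_mono simp: north_step_def east_step_def content_def)
  then show ?thesis
    by (simp add: successively_map flip: successively_conv_sorted_wrt)
qed

text \<open>A path lists its cells in order of content, on which it is injective. This yields the
  uniqueness of Kreiman paths.\<close>

lemma lattice_path_eqI:
  assumes "lattice_path p" "lattice_path q" "set p = set q"
  shows "p = q"
proof -
  have sorted: "sorted_wrt (<) (map content p)" "sorted_wrt (<) (map content q)"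
    using assms lattice_path_sorted_content by blast+
  then have "map content p = map content q"
    using assms(3) by (intro strict_sorted_equal) auto
  moreover have "inj_on content (set p \<union> set q)"
    using sorted(1) assms(3) by (auto simp: strict_sorted_iff distinct_map)
  ultimately show ?thesis by (rule map_inj_on)
qed

text \<open>
  Row \<open>r\<close> of the path starts in the column \<open>m (r + 1)\<close> in which it is entered from below and
  is left northwards in the column \<open>m r\<close>.
\<close>

definition staircase :: "int \<Rightarrow> int \<Rightarrow> (int \<Rightarrow> int) \<Rightarrow> cell set" where
  "staircase c a m = {(r, j). c \<le> r \<and> r \<le> a \<and> m (r + 1) \<le> j \<and> j \<le> m r}"

lemma lattice_path_row:
  assumes "i \<le> j"
  shows "lattice_path (map (Pair r) [i..j])" "hd (map (Pair r) [i..j]) = (r, i)"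
    "last (map (Pair r) [i..j]) = (r, j)"
proof -
  show "lattice_path (map (Pair r) [i..j])"
    using assms by (auto simp: lattice_path_def successively_map successively_conv_nth east_step_def)
  show "hd (map (Pair r) [i..j]) = (r, i)"
    using assms by (simp add: upto_rec1)
  show "last (map (Pair r) [i..j]) = (r, j)"
    using assms by (simp add: upto_rec2)
qed

lemma lattice_path_append:
  assumes "lattice_path p" "lattice_path q" "north_step (last p) (hd q)"
  shows "lattice_path (p @ q)"
  using assms by (auto simp: lattice_path_def successively_append_iff)

text \<open>Induction from the top row \<open>c\<close> downwards: each new bottom row is prepended
  and ends directly below the start of the path built so far.\<close>

lemma staircase_lattice_path:
  assumes "c \<le> a" and "\<And>r. c \<le> r \<Longrightarrow> r \<le> a \<Longrightarrow> m (r + 1) \<le> m r"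
  shows "\<exists>p. lattice_path p \<and> hd p = (a, m (a + 1)) \<and> last p = (c, m c) \<and> set p = staircase c a m"
  using assms
proof (induction a rule: int_ge_induct)
  case base
  then have "m (c + 1) \<le> m c" by simp
  from lattice_path_row[OF this, of c] show ?case
    by (intro exI[of _ "map (Pair c) [m (c + 1)..m c]"]) (auto simp: staircase_def)
next
  case (step a)
  then obtain p where p: "lattice_path p" "hd p = (a, m (a + 1))" "last p = (c, m c)"
    "set p = staircase c a m" by force
  define q where "q = map (Pair (a + 1)) [m (a + 1 + 1)..m (a + 1)]"
  have "m (a + 1 + 1) \<le> m (a + 1)" using step.hyps step.prems[of "a + 1"] by simp
  note q = lattice_path_row[OF this, of "a + 1", folded q_def]
  have "lattice_path (q @ p)"
    using p q by (intro lattice_path_append) (auto simp: north_step_def)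
  have "set q = {(r, j). r = a + 1 \<and> m (a + 1 + 1) \<le> j \<and> j \<le> m (a + 1)}"
    by (auto simp: q_def)
  moreover have "r \<le> a + 1 \<longleftrightarrow> r = a + 1 \<or> r \<le> a" for r
    by linarith
  ultimately have "set (q @ p) = staircase c (a + 1) m"
    using p(4) step.hyps by (auto simp: staircase_def)
  moreover have "q \<noteq> []" "p \<noteq> []" using q(1) p(1) by (auto simp: lattice_path_def)
  ultimately show ?case
    using \<open>lattice_path (q @ p)\<close> p q by (intro exI[of _ "q @ p"]) auto
qed

section \<open>Border strips\<close>

locale nonempty_border_strip =
  fixes lam mu :: "nat list"
  assumes border_strip: "border_strip lam mu"
    and nonempty: "skew_diagram lam mu \<noteq> {}"
begin

abbreviation "S \<equiv> skew_diagram lam mu"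

lemma skew_shape: "skew_shape lam mu"
  using border_strip by (simp add: border_strip_def)

lemma S_subset: "S \<subseteq> diagram lam"
  by (auto simp: skew_diagram_def)

lemma finite_S: "finite S"
  using finite_subset[OF S_subset finite_diagram] .

text \<open>By convexity the two cells would span a 2x2 square inside the strip.\<close>

lemma no_diagonal:
  assumes "(i, j) \<in> S" "(i + 1, j + 1) \<in> diagram lam"
  shows False
proof -
  have "(x, y) \<in> S" if "x \<in> {i, i + 1}" "y \<in> {j, j + 1}" for x y
    using skew_diagram_convex[OF skew_shape assms, of x y] that by auto
  then show False using border_strip unfolding border_strip_def by blast
qed

text \<open>Of two strip cells on one diagonal, the upper one would by convexity have its SE
  neighbour in the strip.\<close>

lemma inj_on_content: "inj_on content S"
proof -
  have False if u: "u \<in> S" and v: "v \<in> S" and eq: "content u = content v" and lt: "fst u < fst v" for u v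
  proof -
    obtain i j i' j' where ij: "u = (i, j)" "v = (i', j')" by (cases u, cases v)
    have "(i + 1, j + 1) \<in> S"
      using skew_diagram_convex[OF skew_shape, of i j i' j' "i + 1" "j + 1"] u v S_subset eq lt
      by (auto simp: ij content_def)
    then show False using no_diagonal u S_subset by (auto simp: ij)
  qed
  then show ?thesis
    unfolding inj_on_def by (metis content_def linorder_neqE prod_eq_iff diff_add_cancel)
qed

text \<open>The strip is parametrized by content, from its SW end at \<open>lo\<close> to its NE end
  at \<open>hi\<close>. \<open>scell k\<close> is meaningful only for \<open>k\<close> in this
  range.\<close>

definition "lo = Min (content ` S)"
definition "hi = Max (content ` S)"
definition "scell = the_inv_into S content"

abbreviation "R k \<equiv> fst (scell k)"
abbreviation "C k \<equiv> snd (scell k)"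
abbreviation "north k \<equiv> north_step (scell k) (scell (k + 1))"
abbreviation "east k \<equiv> east_step (scell k) (scell (k + 1))"

lemma scell_content: "u \<in> S \<Longrightarrow> scell (content u) = u"
  by (simp add: scell_def the_inv_into_f_f inj_on_content)

lemma content_bounds: "u \<in> S \<Longrightarrow> lo \<le> content u \<and> content u \<le> hi"
  by (simp add: lo_def hi_def finite_S)

lemma lo_hi_attained: "lo \<in> content ` S" "hi \<in> content ` S"
  using Min_in[of "content ` S"] Max_in[of "content ` S"] finite_S nonempty
  by (auto simp: lo_def hi_def)

lemma lo_le_hi: "lo \<le> hi"
  using lo_hi_attained content_bounds by force

text \<open>Adjacent cells differ in content by one, so a connecting path meets every content in between.\<close>

lemma content_crossing:
  assumes "(u, v) \<in> (cell_adj S)\<^sup>*" "content u \<le> k" "k < content v"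
  shows "\<exists>x y. (x, y) \<in> cell_adj S \<and> content x = k \<and> content y = k + 1"
  using assms
proof (induction rule: rtrancl_induct)
  case (step v w)
  then have "content w \<le> content v + 1"
    by (auto simp: cell_adj_def content_def)
  then consider "k < content v" | "content v = k" "content w = k + 1"
    using step.prems by linarith
  then show ?case
  proof cases
    case 1
    then show ?thesis by (rule step.IH[OF step.prems(1)])
  next
    case 2
    then show ?thesis using step.hyps(2) by blast
  qed
qed simp

text \<open>Connectedness yields adjacent strip cells of contents \<open>k\<close> and
  \<open>k + 1\<close>, and injectivity of content identifies them. Adjacency with content rising by
  1 leaves only a north or an east step.\<close>

lemma scell_step:
  assumes "lo \<le> k" "k < hi"
  shows "scell k \<in> S" "scell (k + 1) \<in> S" "north k \<or> east k"
proof -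
  obtain u v where uv: "u \<in> S" "v \<in> S" "content u = lo" "content v = hi"
    using lo_hi_attained by force
  then have "(u, v) \<in> (cell_adj S)\<^sup>*"
    using border_strip by (auto simp: border_strip_def cells_connected_def)
  from content_crossing[OF this, of k] uv assms obtain x y where
    xy: "(x, y) \<in> cell_adj S" "content x = k" "content y = k + 1" by auto
  then have S: "x \<in> S" "y \<in> S" by (auto simp: cell_adj_def)
  then have eq: "scell k = x" "scell (k + 1) = y"
    using xy(2,3) scell_content[of x] scell_content[of y] by simp_all
  with S show "scell k \<in> S" "scell (k + 1) \<in> S" by auto
  show "north k \<or> east k"
    using xy unfolding eq
    by (cases x, cases y) (auto simp: cell_adj_def content_def north_step_def east_step_def)
qed

lemma scell_in:
  assumes "lo \<le> k" "k \<le> hi"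
  shows "scell k \<in> S" "content (scell k) = k"
proof -
  show *: "scell k \<in> S"
  proof (cases "k < hi")
    case False
    then show ?thesis using assms lo_hi_attained(2) scell_content by force
  qed (use assms scell_step in auto)
  show "content (scell k) = k"
    using assms
  proof (induction k rule: int_ge_induct)
    case base
    then show ?case using lo_hi_attained(1) scell_content by force
  next
    case (step i)
    then show ?case using scell_step(3)[of i]
      by (auto simp: content_def north_step_def east_step_def)
  qed
qed

lemma S_cases:
  assumes "u \<in> S"
  obtains k where "lo \<le> k" "k \<le> hi" "u = scell k"
  using that[of "content u"] content_bounds[OF assms] scell_content[OF assms] by simp

lemma scell_mono:
  assumes "lo \<le> k" "k \<le> l" "l \<le> hi"
  shows "R l \<le> R k" "C k \<le> C l"
proof -
  have "k \<le> l \<Longrightarrow> l \<le> hi \<Longrightarrow> R l \<le> R k \<and> C k \<le> C l"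
  proof (induction l rule: int_ge_induct)
    case (step i)
    then show ?case using scell_step(3)[of i] assms(1)
      by (auto simp: north_step_def east_step_def)
  qed simp
  with assms show "R l \<le> R k" "C k \<le> C l" by auto
qed

lemma scell_in_diagram: "lo \<le> k \<Longrightarrow> k \<le> hi \<Longrightarrow> scell k \<in> diagram lam"
  using scell_in S_subset by blast

text \<open>A cell of \<open>lam\<close> east of a strip cell cannot lie in \<open>mu\<close>, so it
  is the strip cell of the next content. A northern neighbour may lie in \<open>mu\<close>, which is
  why \<open>north_cell\<close> asks for membership in \<open>S\<close>.\<close>

lemma east_cell:
  assumes "lo \<le> k" "k \<le> hi" "(R k, C k + 1) \<in> diagram lam"
  shows "k < hi" "scell (k + 1) = (R k, C k + 1)"
proof -
  have "(R k, C k + 1) \<in> S"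
    using skew_diagram_convex[OF skew_shape _ assms(3), of "R k" "C k" "R k" "C k + 1"]
      scell_in(1)[OF assms(1,2)] by simp
  moreover have "content (R k, C k + 1) = k + 1"
    using scell_in(2)[OF assms(1,2)] by (simp add: content_def)
  ultimately show "k < hi" "scell (k + 1) = (R k, C k + 1)"
    using content_bounds[of "(R k, C k + 1)"] scell_content[of "(R k, C k + 1)"] by simp_all
qed

lemma north_cell:
  assumes "lo \<le> k" "k \<le> hi" "(R k - 1, C k) \<in> S"
  shows "k < hi" "scell (k + 1) = (R k - 1, C k)"
proof -
  have "content (R k - 1, C k) = k + 1"
    using scell_in(2)[OF assms(1,2)] by (simp add: content_def)
  then show "k < hi" "scell (k + 1) = (R k - 1, C k)"
    using content_bounds[OF assms(3)] scell_content[OF assms(3)] by simp_all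
qed


section \<open>The Hillman--Grassl map on a border strip\<close>

text \<open>The reverse plane partition condition read along consecutive strip cells. Going north
  reverses the inequality, and it is weak because Hillman--Grassl steps do not preserve
  strictness.\<close>

definition strip_rpp :: "(cell \<Rightarrow> nat) \<Rightarrow> bool" where
  "strip_rpp \<pi> \<longleftrightarrow> (\<forall>u. u \<notin> S \<longrightarrow> \<pi> u = 0) \<and>
     (\<forall>k. lo \<le> k \<longrightarrow> k < hi \<longrightarrow>
        (east k \<longrightarrow> \<pi> (scell k) \<le> \<pi> (scell (k + 1))) \<and>
        (north k \<longrightarrow> \<pi> (scell (k + 1)) \<le> \<pi> (scell k)))"

lemma strip_rpp_support:
  assumes "strip_rpp \<pi>" "\<pi> u \<noteq> 0"
  shows "u \<in> S"
proof -
  have "\<forall>u. u \<notin> S \<longrightarrow> \<pi> u = 0" using assms(1) unfolding strip_rpp_def by (rule conjunct1)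
  with assms(2) show ?thesis by metis
qed

lemma not_north_and_east: "north k \<Longrightarrow> east k \<Longrightarrow> False"
  by (auto simp: north_step_def east_step_def)

text \<open>Induction on the distance to the NE end. Before that end, the path goes on to the next
  strip cell unless that cell is north with a smaller entry; then \<open>lam\<close> has no cell to
  the east, as such a cell would have to be the next strip cell.\<close>

lemma hg_path_strip:
  assumes "strip_rpp \<pi>" "lo \<le> k" "k \<le> hi" "\<pi> (scell k) \<noteq> 0"
  shows "\<exists>e. k \<le> e \<and> e \<le> hi \<and> hg_path lam \<pi> (R k) (C k) = map scell [k..e] \<and>
           (\<forall>l. k \<le> l \<longrightarrow> l \<le> e \<longrightarrow> \<pi> (scell l) \<noteq> 0) \<and>
           (\<forall>l. k \<le> l \<longrightarrow> l < e \<longrightarrow> north l \<longrightarrow> \<pi> (scell (l + 1)) = \<pi> (scell l)) \<and>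
           (e < hi \<longrightarrow> north e \<and> \<pi> (scell (e + 1)) < \<pi> (scell e))"
  using assms(2-)
proof (induction "nat (hi - k)" arbitrary: k rule: less_induct)
  case less
  let ?go = "k < hi \<and> (north k \<longrightarrow> \<pi> (scell (k + 1)) = \<pi> (scell k))"
  \<comment> \<open>A northern neighbour off the strip carries 0, which differs from the nonzero
    current entry; equality thus forces it into the strip.\<close>
  have up: "(R k - 1, C k) \<in> diagram lam \<and> \<pi> (R k - 1, C k) = \<pi> (R k, C k) \<longleftrightarrow>
      k < hi \<and> north k \<and> \<pi> (scell (k + 1)) = \<pi> (scell k)" (is "?up \<longleftrightarrow> ?up'")
  proof
    assume ?up
    then have "(R k - 1, C k) \<in> S"
      using less.prems(3) assms(1) by (metis strip_rpp_def prod.collapse)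
    with \<open>?up\<close> show ?up'
      using north_cell[OF less.prems(1,2)] by (simp add: north_step_def)
  next
    assume ?up'
    then show ?up
      using scell_in_diagram[of "k + 1"] less.prems by (auto simp: north_step_def)
  qed
  have right: "(R k, C k + 1) \<in> diagram lam \<longleftrightarrow> k < hi \<and> east k"
  proof
    assume "(R k, C k + 1) \<in> diagram lam"
    then show "k < hi \<and> east k"
      using east_cell[OF less.prems(1,2)] by (simp add: east_step_def)
  next
    assume "k < hi \<and> east k"
    then show "(R k, C k + 1) \<in> diagram lam"
      using scell_in_diagram[of "k + 1"] less.prems by (simp add: east_step_def)
  qed
  have path: "hg_path lam \<pi> (R k) (C k) =
      scell k # (if ?go then hg_path lam \<pi> (R (k + 1)) (C (k + 1)) else [])"
  proof -
    have "hg_path lam \<pi> (R k) (C k) = (R k, C k) # (if ?up' then hg_path lam \<pi> (R k - 1) (C k)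
        else if k < hi \<and> east k then hg_path lam \<pi> (R k) (C k + 1) else [])"
      by (subst hg_path.simps) (simp only: up right)
    moreover have "north k \<or> east k" if "k < hi"
      using that scell_step(3) less.prems by blast
    ultimately show ?thesis
      using not_north_and_east[of k] by (auto simp: north_step_def east_step_def)
  qed
  show ?case
  proof (cases ?go)
    case True
    then have step: "north k \<or> east k" using scell_step(3) less.prems by blast
    \<comment> \<open>Entries do not decrease along the steps taken, so the next cell is again
      nonzero and the induction hypothesis applies.\<close>
    then have "\<pi> (scell k) \<le> \<pi> (scell (k + 1))"
      using True assms(1) less.prems by (auto simp: strip_rpp_def)
    then have nz: "\<pi> (scell (k + 1)) \<noteq> 0" using less.prems by simp
    obtain e where e: "k + 1 \<le> e" "e \<le> hi"
        "hg_path lam \<pi> (R (k + 1)) (C (k + 1)) = map scell [k + 1..e]"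
        "\<forall>l. k + 1 \<le> l \<longrightarrow> l \<le> e \<longrightarrow> \<pi> (scell l) \<noteq> 0"
        "\<forall>l. k + 1 \<le> l \<longrightarrow> l < e \<longrightarrow> north l \<longrightarrow> \<pi> (scell (l + 1)) = \<pi> (scell l)"
        "e < hi \<longrightarrow> north e \<and> \<pi> (scell (e + 1)) < \<pi> (scell e)"
      using less.hyps[of "k + 1"] True less.prems nz by auto
    have split: "l = k \<or> k + 1 \<le> l" if "k \<le> l" for l using that by linarith
    show ?thesis
    proof (intro exI[of _ e] conjI)
      show "hg_path lam \<pi> (R k) (C k) = map scell [k..e]"
        using path True e(1,3) by (simp add: upto_rec1)
      show "\<forall>l. k \<le> l \<longrightarrow> l \<le> e \<longrightarrow> \<pi> (scell l) \<noteq> 0"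
        using split e(4) less.prems by metis
      show "\<forall>l. k \<le> l \<longrightarrow> l < e \<longrightarrow> north l \<longrightarrow> \<pi> (scell (l + 1)) = \<pi> (scell l)"
        using split e(5) True by metis
    qed (use e in auto)
  next
    case False
    have "k < hi \<longrightarrow> north k \<and> \<pi> (scell (k + 1)) < \<pi> (scell k)"
      using False assms(1) less.prems by (auto simp: strip_rpp_def le_less)
    moreover have "hg_path lam \<pi> (R k) (C k) = map scell [k..k]"
      using path False by simp
    ultimately show ?thesis using less.prems by (intro exI[of _ k]) auto
  qed
qed

text \<open>Towards the NE end column indices weakly increase and row indices weakly decrease, so
  the first nonzero cell is in the leftmost nonzero column and lowest in it.\<close>

lemma hg_start_strip:
  assumes "strip_rpp \<pi>" "\<exists>u \<in> diagram lam. \<pi> u \<noteq> 0"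
  shows "\<exists>s. lo \<le> s \<and> s \<le> hi \<and> \<pi> (scell s) \<noteq> 0 \<and>
           (\<forall>k. lo \<le> k \<longrightarrow> k < s \<longrightarrow> \<pi> (scell k) = 0) \<and>
           hg_start_col lam \<pi> = C s \<and> hg_start_row lam \<pi> = R s"
proof -
  define K where "K = {k. lo \<le> k \<and> k \<le> hi \<and> \<pi> (scell k) \<noteq> 0}"
  have K_cases: "\<exists>k \<in> K. u = scell k" if "\<pi> u \<noteq> 0" for u
  proof -
    have "u \<in> S" using assms(1) that by (rule strip_rpp_support)
    then obtain k where "lo \<le> k" "k \<le> hi" "u = scell k" by (rule S_cases)
    then show ?thesis using that by (auto simp: K_def)
  qed
  have fin: "finite K" by (rule finite_subset[of _ "{lo..hi}"]) (auto simp: K_def)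
  moreover have "K \<noteq> {}" using K_cases assms(2) by blast
  ultimately have s: "Min K \<in> K" and min: "\<And>k. k \<in> K \<Longrightarrow> Min K \<le> k" by auto
  define s where "s = Min K"
  note s = s[folded s_def] and min = min[folded s_def]
  from s have sb: "lo \<le> s" "s \<le> hi" "\<pi> (scell s) \<noteq> 0" by (auto simp: K_def)
  have col: "hg_start_col lam \<pi> = C s"
    unfolding hg_start_col_def
  proof (rule Min_eqI)
    show "finite {b. \<exists>a. (a, b) \<in> diagram lam \<and> \<pi> (a, b) \<noteq> 0}"
      by (rule finite_subset[OF _ finite_imageI[OF finite_diagram, of snd lam]]) force
    show "C s \<in> {b. \<exists>a. (a, b) \<in> diagram lam \<and> \<pi> (a, b) \<noteq> 0}"
      using sb scell_in_diagram[of s] by (metis (mono_tags, lifting) mem_Collect_eq prod.collapse)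
    fix b assume "b \<in> {b. \<exists>a. (a, b) \<in> diagram lam \<and> \<pi> (a, b) \<noteq> 0}"
    then obtain a k where "k \<in> K" "(a, b) = scell k" using K_cases by blast
    moreover from this have "s \<le> k" "k \<le> hi" using min by (auto simp: K_def)
    ultimately show "C s \<le> b"
      using scell_mono(2)[of s k] sb(1) by (metis snd_conv)
  qed
  have "hg_start_row lam \<pi> = R s"
    unfolding hg_start_row_def col
  proof (rule Max_eqI)
    show "finite {a. (a, C s) \<in> diagram lam \<and> \<pi> (a, C s) \<noteq> 0}"
      by (rule finite_subset[OF _ finite_imageI[OF finite_diagram, of fst lam]]) force
    show "R s \<in> {a. (a, C s) \<in> diagram lam \<and> \<pi> (a, C s) \<noteq> 0}"
      using sb scell_in_diagram[of s] by auto
    fix a assume "a \<in> {a. (a, C s) \<in> diagram lam \<and> \<pi> (a, C s) \<noteq> 0}"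
    then obtain k where "k \<in> K" "(a, C s) = scell k" using K_cases by blast
    moreover from this have "s \<le> k" "k \<le> hi" using min by (auto simp: K_def)
    ultimately show "a \<le> R s"
      using scell_mono(1)[of s k] sb(1) by (metis fst_conv)
  qed
  moreover have "\<pi> (scell k) = 0" if "lo \<le> k" "k < s" for k
    using min[of k] that sb by (auto simp: K_def)
  ultimately show ?thesis using sb col by blast
qed

lemma scell_in_segment_iff:
  assumes "lo \<le> s" "e \<le> hi" "lo \<le> k" "k \<le> hi"
  shows "scell k \<in> scell ` {s..e} \<longleftrightarrow> s \<le> k \<and> k \<le> e"
proof
  assume "scell k \<in> scell ` {s..e}"
  then obtain l where l: "s \<le> l" "l \<le> e" "scell k = scell l"
    unfolding image_iff by (metis atLeastAtMost_iff)
  have "content (scell k) = k" using assms(3,4) by (rule scell_in(2))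
  moreover have "content (scell l) = l"
    using assms(1,2) l(1,2) by (intro scell_in(2)) linarith+
  ultimately have "k = l" using l(3) by metis
  with l(1,2) show "s \<le> k \<and> k \<le> e" by blast
next
  assume "s \<le> k \<and> k \<le> e"
  then show "scell k \<in> scell ` {s..e}" by (intro imageI) simp
qed

lemma hg_step_strip:
  assumes "strip_rpp \<pi>" "\<exists>u \<in> diagram lam. \<pi> u \<noteq> 0"
  obtains s e where "lo \<le> s" "s \<le> e" "e \<le> hi"
    "hg_step lam (\<pi>, A) =
       ((\<lambda>u. if u \<in> scell ` {s..e} then \<pi> u - 1 else \<pi> u), A((R e, C s) := A (R e, C s) + 1))"
    "\<And>k. lo \<le> k \<Longrightarrow> k < s \<Longrightarrow> \<pi> (scell k) = 0"
    "\<And>k. s \<le> k \<Longrightarrow> k \<le> e \<Longrightarrow> \<pi> (scell k) \<noteq> 0"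
    "\<And>k. s \<le> k \<Longrightarrow> k < e \<Longrightarrow> north k \<Longrightarrow> \<pi> (scell (k + 1)) = \<pi> (scell k)"
    "e < hi \<Longrightarrow> north e \<and> \<pi> (scell (e + 1)) < \<pi> (scell e)"
proof -
  obtain s where s: "lo \<le> s" "s \<le> hi" "\<pi> (scell s) \<noteq> 0"
      "\<forall>k. lo \<le> k \<longrightarrow> k < s \<longrightarrow> \<pi> (scell k) = 0"
      "hg_start_col lam \<pi> = C s" "hg_start_row lam \<pi> = R s"
    using hg_start_strip[OF assms] by blast
  obtain e where e: "s \<le> e" "e \<le> hi" "hg_path lam \<pi> (R s) (C s) = map scell [s..e]"
      "\<forall>l. s \<le> l \<longrightarrow> l \<le> e \<longrightarrow> \<pi> (scell l) \<noteq> 0"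
      "\<forall>l. s \<le> l \<longrightarrow> l < e \<longrightarrow> north l \<longrightarrow> \<pi> (scell (l + 1)) = \<pi> (scell l)"
      "e < hi \<longrightarrow> north e \<and> \<pi> (scell (e + 1)) < \<pi> (scell e)"
    using hg_path_strip[OF assms(1) s(1-3)] by blast
  have "last (map scell [s..e]) = scell e" using e(1) by (simp add: upto_rec2)
  then have "hg_step lam (\<pi>, A) =
      ((\<lambda>u. if u \<in> scell ` {s..e} then \<pi> u - 1 else \<pi> u), A((R e, C s) := A (R e, C s) + 1))"
    by (simp add: hg_step_def Let_def s(5,6) e(3))
  with s e that show thesis by blast
qed

text \<open>
  Both the first nonzero cell of the strip and the first strict descent in a column only move
  towards the NE end. The last two conjuncts of the second clause say that all entries still to
  be added lie weakly NE of those present.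
\<close>

definition hg_invariant :: "(cell \<Rightarrow> nat) \<Rightarrow> (cell \<Rightarrow> nat) \<Rightarrow> bool" where
  "hg_invariant \<pi> A \<longleftrightarrow> strip_rpp \<pi> \<and>
     (\<forall>r b. A (r, b) \<noteq> 0 \<longrightarrow>
        (\<exists>s e. lo \<le> s \<and> s \<le> e \<and> e \<le> hi \<and> r = R e \<and> b = C s) \<and>
        (\<forall>k. lo \<le> k \<longrightarrow> k \<le> hi \<longrightarrow> \<pi> (scell k) \<noteq> 0 \<longrightarrow> b \<le> C k) \<and>
        (\<forall>k. lo \<le> k \<longrightarrow> k < hi \<longrightarrow> north k \<longrightarrow> \<pi> (scell (k + 1)) < \<pi> (scell k) \<longrightarrow> R k \<le> r)) \<and>
     (\<forall>r b r' b'. A (r, b) \<noteq> 0 \<longrightarrow> A (r', b') \<noteq> 0 \<longrightarrow> r' < r \<longrightarrow> b \<le> b') \<and>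
     (\<forall>k. lo \<le> k \<longrightarrow> k < hi \<longrightarrow> north k \<longrightarrow>
        \<pi> (scell (k + 1)) < \<pi> (scell k) \<or> (\<exists>b. A (R k, b) \<noteq> 0))"

text \<open>Lowering a segment by 1 changes comparisons only at its two ends. Just before
  \<open>s\<close> the entry is 0; at \<open>e\<close> a strict descent absorbs the loss, and if it
  vanishes, the new array entry in row \<open>R e\<close> takes over. The decreasing sum serves for
  termination.\<close>

lemma hg_invariant_step:
  assumes inv: "hg_invariant \<pi> A" and nz: "\<exists>u \<in> diagram lam. \<pi> u \<noteq> 0"
  shows "case_prod hg_invariant (hg_step lam (\<pi>, A))"
    and "sum (fst (hg_step lam (\<pi>, A))) (diagram lam) < sum \<pi> (diagram lam)"
proof -
  have rpp: "strip_rpp \<pi>" using inv by (simp add: hg_invariant_def)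
  obtain s e where se: "lo \<le> s" "s \<le> e" "e \<le> hi"
    and step: "hg_step lam (\<pi>, A) =
       ((\<lambda>u. if u \<in> scell ` {s..e} then \<pi> u - 1 else \<pi> u), A((R e, C s) := A (R e, C s) + 1))"
    and before: "\<And>k. lo \<le> k \<Longrightarrow> k < s \<Longrightarrow> \<pi> (scell k) = 0"
    and pos: "\<And>k. s \<le> k \<Longrightarrow> k \<le> e \<Longrightarrow> \<pi> (scell k) \<noteq> 0"
    and flat: "\<And>k. s \<le> k \<Longrightarrow> k < e \<Longrightarrow> north k \<Longrightarrow> \<pi> (scell (k + 1)) = \<pi> (scell k)"
    and stop: "e < hi \<Longrightarrow> north e \<and> \<pi> (scell (e + 1)) < \<pi> (scell e)"
    using hg_step_strip[OF rpp nz] by blast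
  \<comment> \<open>By \<open>pos\<close> this subtraction never truncates at 0.\<close>
  define \<pi>' where "\<pi>' = (\<lambda>u. if u \<in> scell ` {s..e} then \<pi> u - 1 else \<pi> u)"
  define A' where "A' = A((R e, C s) := A (R e, C s) + 1)"
  have \<pi>'_eq: "\<pi>' (scell k) = (if s \<le> k \<and> k \<le> e then \<pi> (scell k) - 1 else \<pi> (scell k))"
    if "lo \<le> k" "k \<le> hi" for k
    using scell_in_segment_iff[of s e k] se that by (simp add: \<pi>'_def)
  have A'_nz: "A' (r, b) \<noteq> 0 \<longleftrightarrow> A (r, b) \<noteq> 0 \<or> (r = R e \<and> b = C s)" for r b
    by (auto simp: A'_def)
  have steps: "(east k \<longrightarrow> \<pi>' (scell k) \<le> \<pi>' (scell (k + 1))) \<and>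
      (north k \<longrightarrow> \<pi>' (scell (k + 1)) \<le> \<pi>' (scell k)) \<and>
      (\<pi>' (scell (k + 1)) < \<pi>' (scell k) \<longrightarrow> north k \<longrightarrow> \<pi> (scell (k + 1)) < \<pi> (scell k)) \<and>
      (\<pi> (scell (k + 1)) < \<pi> (scell k) \<longrightarrow> north k \<longrightarrow> k \<noteq> e \<longrightarrow> \<pi>' (scell (k + 1)) < \<pi>' (scell k))"
    if k: "lo \<le> k" "k < hi" for k
  proof -
    have old: "east k \<longrightarrow> \<pi> (scell k) \<le> \<pi> (scell (k + 1))"
        "north k \<longrightarrow> \<pi> (scell (k + 1)) \<le> \<pi> (scell k)"
      using rpp k by (auto simp: strip_rpp_def)
    note eqs = \<pi>'_eq[of k] \<pi>'_eq[of "k + 1"]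
    consider "k + 1 < s \<or> e < k" | "k + 1 = s" | "s \<le> k" "k < e" | "k = e" by linarith
    then show ?thesis
    proof cases
      case 1
      then show ?thesis using eqs k old se by auto
    next
      case 2
      then have "\<pi> (scell k) = 0" "\<pi> (scell (k + 1)) \<noteq> 0"
        using before[of k] pos[of s] k se by auto
      then show ?thesis using eqs k old se 2 by auto
    next
      case 3
      then have "\<pi> (scell k) \<noteq> 0" "\<pi> (scell (k + 1)) \<noteq> 0" using pos by auto
      then show ?thesis using eqs k old se 3 by auto
    next
      case 4
      then have "\<pi> (scell (k + 1)) < \<pi> (scell k)" "north k" using stop k by auto
      then show ?thesis using eqs k se 4 not_north_and_east by auto
    qed
  qed
  have supp: "\<forall>u. u \<notin> S \<longrightarrow> \<pi>' u = 0"
    using rpp by (auto simp: strip_rpp_def \<pi>'_def)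
  then have rpp': "strip_rpp \<pi>'"
    using steps by (auto simp: strip_rpp_def)
  have le: "\<pi>' u \<le> \<pi> u" for u by (simp add: \<pi>'_def)
  \<comment> \<open>No strict descent occurs before \<open>e\<close>: entries before
    \<open>s\<close> are 0, and north steps within the segment are flat.\<close>
  have new_row: "R k \<le> R e" if "lo \<le> k" "k < hi" "north k" "\<pi> (scell (k + 1)) < \<pi> (scell k)" for k
  proof -
    have "e \<le> k"
    proof (rule ccontr)
      assume "\<not> e \<le> k"
      then show False using that before[of k] flat[of k] by (cases "k < s") auto
    qed
    then show ?thesis using scell_mono(1)[of e k] that se by simp
  qed
  have new_col: "C s \<le> C k" if "lo \<le> k" "k \<le> hi" "\<pi> (scell k) \<noteq> 0" for k
    using scell_mono(2)[of s k] before[of k] that se by force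
  have old: "(\<exists>s e. lo \<le> s \<and> s \<le> e \<and> e \<le> hi \<and> r = R e \<and> b = C s)"
      "b \<le> C k \<or> \<not> (lo \<le> k \<and> k \<le> hi \<and> \<pi> (scell k) \<noteq> 0)"
      "R k \<le> r \<or> \<not> (lo \<le> k \<and> k < hi \<and> north k \<and> \<pi> (scell (k + 1)) < \<pi> (scell k))"
    if "A (r, b) \<noteq> 0" for r b k
    using inv that unfolding hg_invariant_def by metis+
  \<comment> \<open>Earlier entries lie weakly SW of the new one: their invariant is applied to the
    nonzero cell at \<open>s\<close> and the descent at \<open>e\<close>. If the path ran to
    \<open>hi\<close>, then \<open>R e\<close> is the top row of the strip.\<close>
  have old_new: "b \<le> C s" "R e \<le> r" if "A (r, b) \<noteq> 0" for r b
  proof -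
    show "b \<le> C s" using old(2)[OF that, of s] pos[of s] se by auto
    show "R e \<le> r"
    proof (cases "e < hi")
      case True
      then show ?thesis using old(3)[OF that, of e] stop se by auto
    next
      case False
      then show ?thesis using old(1)[OF that] scell_mono(1)[of _ hi] se by force
    qed
  qed
  have chain: "b \<le> b'" if "A' (r, b) \<noteq> 0" "A' (r', b') \<noteq> 0" "r' < r" for r b r' b'
    using that old_new[of r b] old_new[of r' b'] inv unfolding A'_nz hg_invariant_def by force
  have entries: "(\<exists>s e. lo \<le> s \<and> s \<le> e \<and> e \<le> hi \<and> r = R e \<and> b = C s) \<and>
        (\<forall>k. lo \<le> k \<longrightarrow> k \<le> hi \<longrightarrow> \<pi>' (scell k) \<noteq> 0 \<longrightarrow> b \<le> C k) \<and>
        (\<forall>k. lo \<le> k \<longrightarrow> k < hi \<longrightarrow> north k \<longrightarrow> \<pi>' (scell (k + 1)) < \<pi>' (scell k) \<longrightarrow> R k \<le> r)"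
    if "A' (r, b) \<noteq> 0" for r b
  proof -
    have nz': "\<pi>' (scell k) \<noteq> 0 \<Longrightarrow> \<pi> (scell k) \<noteq> 0" for k using le[of "scell k"] by auto
    from that consider "A (r, b) \<noteq> 0" | "r = R e" "b = C s" unfolding A'_nz by blast
    then show ?thesis
    proof cases
      case 1
      then show ?thesis using old[OF 1] nz' steps by blast
    next
      case 2
      then show ?thesis using se new_row new_col nz' steps by blast
    qed
  qed
  \<comment> \<open>Only the descent at \<open>e\<close> can vanish, and row \<open>R e\<close> of
    \<open>A'\<close> has a nonzero entry.\<close>
  have cover: "\<pi>' (scell (k + 1)) < \<pi>' (scell k) \<or> (\<exists>b. A' (R k, b) \<noteq> 0)"
    if "lo \<le> k" "k < hi" "north k" for k
    using that steps[of k] inv unfolding A'_nz hg_invariant_def by blast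
  have "hg_invariant \<pi>' A'"
    unfolding hg_invariant_def using rpp' entries chain cover by blast
  then show "case_prod hg_invariant (hg_step lam (\<pi>, A))"
    by (simp add: step \<pi>'_def A'_def)
  have "sum \<pi>' (diagram lam) < sum \<pi> (diagram lam)"
  proof (rule sum_strict_mono_ex1[OF finite_diagram])
    show "\<forall>u \<in> diagram lam. \<pi>' u \<le> \<pi> u" using le by simp
    show "\<exists>u \<in> diagram lam. \<pi>' u < \<pi> u"
      using scell_in_diagram[of s] \<pi>'_eq[of s] pos[of s] se by (intro bexI[of _ "scell s"]) auto
  qed
  then show "sum (fst (hg_step lam (\<pi>, A))) (diagram lam) < sum \<pi> (diagram lam)"
    by (simp add: step \<pi>'_def)
qed

text \<open>Column strictness makes every north step a strict descent, as the covering clause of the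
  invariant demands of the zero array.\<close>

lemma hg_invariant_ssyt:
  assumes "is_ssyt lam mu T"
  shows "hg_invariant (extend_by_zero S T) (\<lambda>_. 0)"
proof -
  have "(east k \<longrightarrow> T (scell k) \<le> T (scell (k + 1))) \<and> (north k \<longrightarrow> T (scell (k + 1)) < T (scell k))"
    if "lo \<le> k" "k < hi" for k
  proof -
    have S: "(R k, C k) \<in> S" "(R (k + 1), C (k + 1)) \<in> S" using scell_step[OF that] by auto
    then show ?thesis
      using assms unfolding is_ssyt_def
      by (cases "scell k", cases "scell (k + 1)") (auto simp: east_step_def north_step_def)
  qed
  moreover have "scell k \<in> S" "scell (k + 1) \<in> S" if "lo \<le> k" "k < hi" for k
    using scell_step[OF that] by auto
  ultimately show ?thesis
    by (auto simp: hg_invariant_def strip_rpp_def extend_by_zero_def less_imp_le)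
qed

lemma HG_ssyt:
  assumes "is_ssyt lam mu T"
  defines "A \<equiv> HG lam (extend_by_zero S T)"
  shows "A (r, b) \<noteq> 0 \<Longrightarrow> \<exists>s e. lo \<le> s \<and> s \<le> e \<and> e \<le> hi \<and> r = R e \<and> b = C s"
    and "A (r, b) \<noteq> 0 \<Longrightarrow> A (r', b') \<noteq> 0 \<Longrightarrow> r' < r \<Longrightarrow> b \<le> b'"
    and "lo \<le> k \<Longrightarrow> k < hi \<Longrightarrow> north k \<Longrightarrow> \<exists>b. A (R k, b) \<noteq> 0"
proof -
  have "\<exists>\<pi>. hg_invariant \<pi> A \<and> (\<forall>u \<in> diagram lam. \<pi> u = 0)"
    unfolding A_def HG_def
  proof (rule while_rule[where P = "case_prod hg_invariant"
        and r = "measure (\<lambda>(\<pi>, A). sum \<pi> (diagram lam))"])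
    show "case_prod hg_invariant (extend_by_zero S T, \<lambda>_. 0)"
      using hg_invariant_ssyt[OF assms(1)] by simp
  next
    fix st :: "(cell \<Rightarrow> nat) \<times> (cell \<Rightarrow> nat)"
    assume "case_prod hg_invariant st" "case st of (\<pi>, A) \<Rightarrow> \<exists>u\<in>diagram lam. \<pi> u \<noteq> 0"
    then show "case_prod hg_invariant (hg_step lam st)"
        "(hg_step lam st, st) \<in> measure (\<lambda>(\<pi>, A). sum \<pi> (diagram lam))"
      using hg_invariant_step[of "fst st" "snd st"] by (auto simp: case_prod_beta)
  qed (auto simp: case_prod_beta)
  then obtain \<pi> where \<pi>: "hg_invariant \<pi> A" "\<forall>u \<in> diagram lam. \<pi> u = 0" by blast
  show "A (r, b) \<noteq> 0 \<Longrightarrow> \<exists>s e. lo \<le> s \<and> s \<le> e \<and> e \<le> hi \<and> r = R e \<and> b = C s"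
    and "A (r, b) \<noteq> 0 \<Longrightarrow> A (r', b') \<noteq> 0 \<Longrightarrow> r' < r \<Longrightarrow> b \<le> b'"
    using \<pi>(1) unfolding hg_invariant_def by blast+
  assume k: "lo \<le> k" "k < hi" "north k"
  \<comment> \<open>No descent can start from an entry 0, so the invariant must supply an array
    entry in this row.\<close>
  then have "\<pi> (scell k) = 0" using \<pi>(2) scell_in_diagram[of k] by simp
  then show "\<exists>b. A (R k, b) \<noteq> 0"
    using \<pi>(1) k unfolding hg_invariant_def by (metis not_less_zero)
qed


section \<open>Excited diagrams as complements of staircases\<close>

abbreviation "row_length r \<equiv> int (lam ! nat (r - 1))"

text \<open>The strip itself is the staircase whose rows extend to the end of the rows of \<open>lam\<close>.\<close>

definition "strip_ends r = (if r = R lo + 1 then C lo else row_length r)"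

lemma rows:
  assumes "R hi \<le> r" "r \<le> R lo"
  shows "(r, j) \<in> diagram lam \<longleftrightarrow> 1 \<le> j \<and> j \<le> row_length r"
  using assms scell_in_diagram[of lo] scell_in_diagram[of hi] lo_le_hi
  by (auto simp: diagram_def case_prod_beta)

text \<open>A further cell of \<open>lam\<close> to the east would be the next strip cell, contrary
  to a north step or to \<open>k = hi\<close>.\<close>

lemma row_end:
  assumes "lo \<le> k" "k \<le> hi" "k < hi \<longrightarrow> north k"
  shows "C k = row_length (R k)"
proof -
  have "(R k, C k + 1) \<notin> diagram lam"
    using east_cell[OF assms(1,2)] assms(3) by (auto simp: north_step_def)
  moreover have "(R k, C k) \<in> diagram lam" using scell_in_diagram[OF assms(1,2)] by simp
  ultimately show ?thesis by (auto simp: diagram_def)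
qed

text \<open>The row index drops by at most 1 per step, so on its way to the top the strip must leave
  row \<open>r + 1\<close> northwards.\<close>

lemma north_step_from_row:
  assumes "R hi \<le> r" "r < R lo"
  obtains k where "lo \<le> k" "k < hi" "north k" "R k = r + 1"
proof -
  have "\<exists>k. lo \<le> k \<and> k < l \<and> north k \<and> R k = r + 1" if "lo \<le> l" "l \<le> hi" "R l \<le> r" for l
    using that
  proof (induction l rule: int_ge_induct)
    case base
    then show ?case using assms(2) by simp
  next
    case (step i)
    show ?case
    proof (cases "R i \<le> r")
      case True
      then obtain k where "lo \<le> k" "k < i" "north k" "R k = r + 1" using step by auto
      then show ?thesis by (intro exI[of _ k]) simp
    next
      case False
      then have "north i" "R i = r + 1"
        using step scell_step(3)[of i] by (auto simp: north_step_def east_step_def)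
      then show ?thesis using step.hyps by (intro exI[of _ i]) simp
    qed
  qed
  from this[of hi] show thesis using that assms(1) lo_le_hi by auto
qed

lemma strip_eq_staircase: "S = staircase (R hi) (R lo) strip_ends"
proof (intro set_eqI iffI)
  fix u assume u: "u \<in> S"
  obtain r j where rj: "u = (r, j)" by (cases u)
  obtain k where k: "lo \<le> k" "k \<le> hi" "u = scell k" using u by (rule S_cases)
  have bounds: "R hi \<le> r" "r \<le> R lo" "C lo \<le> j"
    using scell_mono[of lo k] scell_mono[of k hi] k rj by (metis order_refl fst_conv snd_conv)+
  have "j \<le> row_length r"
    using rows[OF bounds(1,2)] u S_subset by (auto simp: rj)
  \<comment> \<open>Otherwise the SE neighbour of the cell would lie in \<open>lam\<close>.\<close>
  moreover have "row_length (r + 1) \<le> j" if "r < R lo"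
  proof (rule ccontr)
    assume "\<not> row_length (r + 1) \<le> j"
    moreover have "1 \<le> j" using u by (auto simp: rj skew_diagram_def diagram_def)
    ultimately have "(r + 1, j + 1) \<in> diagram lam" using rows[of "r + 1"] that bounds by simp
    then show False using no_diagonal u by (simp add: rj)
  qed
  ultimately show "u \<in> staircase (R hi) (R lo) strip_ends"
    using bounds by (auto simp: staircase_def strip_ends_def rj)
next
  fix u assume "u \<in> staircase (R hi) (R lo) strip_ends"
  then obtain r j where rj: "u = (r, j)" "R hi \<le> r" "r \<le> R lo" "strip_ends (r + 1) \<le> j"
      "j \<le> strip_ends r"
    by (auto simp: staircase_def)
  \<comment> \<open>A row begins at the SW end of the strip or directly above the end of the row
    below; convexity then fills it up.\<close>
  have start: "(r, strip_ends (r + 1)) \<in> S"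
  proof (cases "r = R lo")
    case True
    then show ?thesis using scell_in(1)[of lo] lo_le_hi by (simp add: strip_ends_def)
  next
    case False
    then obtain k where k: "lo \<le> k" "k < hi" "north k" "R k = r + 1"
      using north_step_from_row rj(2,3) by (metis order_le_less)
    then have "C k = row_length (r + 1)" using row_end[of k] by simp
    then have "scell (k + 1) = (r, strip_ends (r + 1))"
      using k False by (simp add: north_step_def strip_ends_def)
    then show ?thesis using scell_step(2)[OF k(1,2)] by simp
  qed
  then have "1 \<le> strip_ends (r + 1)" by (simp add: skew_diagram_def diagram_def)
  then have "(r, j) \<in> diagram lam"
    using rows[OF rj(2,3)] rj by (simp add: strip_ends_def)
  then show "u \<in> S"
    using skew_diagram_convex[OF skew_shape start, of r j r j] rj by simp
qed

end

text \<open>Leaving row \<open>r\<close> one column later trades the corner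
  \<open>(r - 1, m r)\<close> for its SE neighbour; on complements this is an excited move read
  backwards.\<close>

lemma staircase_update:
  assumes "c < r" "r \<le> a" "m (r + 1) \<le> m r" "m r < m (r - 1)"
  shows "staircase c a (m(r := m r + 1)) = insert (r, m r + 1) (staircase c a m - {(r - 1, m r)})"
proof (rule set_eqI)
  fix u :: cell
  obtain x y where u: "u = (x, y)" by (cases u)
  consider "x = r" | "x = r - 1" | "x \<noteq> r" "x + 1 \<noteq> r" by linarith
  then show "u \<in> staircase c a (m(r := m r + 1)) \<longleftrightarrow>
      u \<in> insert (r, m r + 1) (staircase c a m - {(r - 1, m r)})"
    using assms by cases (auto simp: staircase_def u)
qed

context nonempty_border_strip
begin

text \<open>Induction on the total distance of the rows of the staircase from the row ends of
  \<open>lam\<close>. At distance 0 the staircase is the strip and its complement is the diagram of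
  \<open>mu\<close>.\<close>

lemma staircase_complement_excited:
  assumes "m (R lo + 1) = C lo" "m (R hi) = C hi"
    and "\<And>r. R hi \<le> r \<Longrightarrow> r \<le> R lo \<Longrightarrow> m (r + 1) \<le> m r"
    and "staircase (R hi) (R lo) m \<subseteq> diagram lam"
  shows "diagram lam - staircase (R hi) (R lo) m \<in> excited_diagrams lam mu"
  using assms
proof (induction "\<Sum>r = R hi..R lo. nat (row_length r - m r)" arbitrary: m rule: less_induct)
  case less
  have in_diagram: "1 \<le> m r" "m r \<le> row_length r" if "R hi \<le> r" "r \<le> R lo" for r
  proof -
    have "(r, m r) \<in> diagram lam"
      using that less.prems(3)[OF that] less.prems(4) by (auto simp: staircase_def)
    then show "1 \<le> m r" "m r \<le> row_length r" using rows[OF that] by auto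
  qed
  show ?case
  proof (cases "\<exists>r. R hi \<le> r \<and> r \<le> R lo \<and> m r < row_length r")
    case False
    then have full: "row_length r \<le> m r" if "R hi \<le> r" "r \<le> R lo" for r
      using that by (meson not_le)
    have "m r = strip_ends r" if "R hi \<le> r" "r \<le> R lo + 1" for r
    proof (cases "r = R lo + 1")
      case False
      then have "r \<le> R lo" using that by simp
      then show ?thesis
        using in_diagram(2)[of r] full[of r] that(1) False by (simp add: strip_ends_def)
    qed (simp add: strip_ends_def less.prems(1))
    then have "staircase (R hi) (R lo) m = S"
      unfolding strip_eq_staircase by (auto simp: staircase_def)
    moreover have "diagram lam - S = diagram mu"
      using skew_shape by (auto simp: skew_shape_def skew_diagram_def)
    ultimately show ?thesis by (simp add: excited_diagrams.base)
  next
    case True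
    \<comment> \<open>\<open>r\<close> is the topmost row that stops short of its end. The row above
      it is full and at least as long, so the corner has room to be pushed SE.\<close>
    define Q where "Q = {r. R hi \<le> r \<and> r \<le> R lo \<and> m r < row_length r}"
    define r where "r = Min Q"
    have fin: "finite Q" by (rule finite_subset[of _ "{R hi..R lo}"]) (auto simp: Q_def)
    then have "r \<in> Q" using True unfolding r_def by (intro Min_in) (auto simp: Q_def)
    then have r: "R hi \<le> r" "r \<le> R lo" "m r < row_length r" by (auto simp: Q_def)
    \<comment> \<open>The NE end of the strip closes its row, so the top row is never short.\<close>
    have "m (R hi) = row_length (R hi)"
      using less.prems(2) row_end[of hi] lo_le_hi by simp
    then have "R hi < r" using r by (cases "r = R hi") auto
    then have r1: "R hi \<le> r - 1" "r - 1 \<le> R lo" using r by auto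
    have "r - 1 \<notin> Q" using Min_le[OF fin, of "r - 1"] by (auto simp flip: r_def)
    then have above: "m (r - 1) = row_length (r - 1)"
      using r1 in_diagram[OF r1] by (auto simp: Q_def)
    have "(r, m r + 1) \<in> diagram lam" using rows[OF r(1,2)] r(3) in_diagram[OF r(1,2)] by simp
    then have "(r - 1, m r + 1) \<in> diagram lam"
      using diagram_down_closed[of lam r "m r + 1" "r - 1" "m r + 1"] skew_shape r1
        in_diagram[OF r(1,2)] scell_in_diagram[of hi] lo_le_hi
      by (auto simp: skew_shape_def diagram_def case_prod_beta)
    then have "m r + 1 \<le> m (r - 1)" using rows[OF r1] above by simp
    define m' where "m' = m(r := m r + 1)"
    have upd: "staircase (R hi) (R lo) m' =
        insert (r, m r + 1) (staircase (R hi) (R lo) m - {(r - 1, m r)})"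
      unfolding m'_def using \<open>R hi < r\<close> r(2) less.prems(3)[OF r(1,2)] \<open>m r + 1 \<le> m (r - 1)\<close>
      by (intro staircase_update) auto
    have mem: "(r - 1, m r) \<in> staircase (R hi) (R lo) m" "(r, m r + 1) \<notin> staircase (R hi) (R lo) m"
      using r1 \<open>m r + 1 \<le> m (r - 1)\<close> by (auto simp: staircase_def)
    let ?D = "diagram lam - staircase (R hi) (R lo) m'"
    have sub': "staircase (R hi) (R lo) m' \<subseteq> diagram lam"
      using upd less.prems(4) \<open>(r, m r + 1) \<in> diagram lam\<close> by auto
    have "?D \<in> excited_diagrams lam mu"
    proof (rule less.hyps)
      show "(\<Sum>r = R hi..R lo. nat (row_length r - m' r)) < (\<Sum>r = R hi..R lo. nat (row_length r - m r))"
        by (rule sum_strict_mono_ex1) (use r in \<open>auto simp: m'_def intro!: bexI[of _ r]\<close>)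
      show "m' (R lo + 1) = C lo" "m' (R hi) = C hi"
        using less.prems(1,2) r(2) \<open>R hi < r\<close> by (auto simp: m'_def)
      show "m' (x + 1) \<le> m' x" if "R hi \<le> x" "x \<le> R lo" for x
        using less.prems(3)[OF that] \<open>m r + 1 \<le> m (r - 1)\<close>
        by (auto simp: m'_def)
      show "staircase (R hi) (R lo) m' \<subseteq> diagram lam" by (rule sub')
    qed
    \<comment> \<open>\<open>?D\<close> is an excited diagram by induction; moving its cell
      \<open>(r - 1, m r)\<close> gives back the complement of the staircase of
      \<open>m\<close>.\<close>
    moreover have "active_cell lam ?D (r - 1) (m r)"
    proof -
      have "(r, m r) \<in> staircase (R hi) (R lo) m'" "(r - 1, m r + 1) \<in> staircase (R hi) (R lo) m'"
          "(r, m r + 1) \<in> staircase (R hi) (R lo) m'"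
        using r r1 less.prems(3)[OF r(1,2)] \<open>m r + 1 \<le> m (r - 1)\<close>
        by (auto simp: staircase_def m'_def)
      moreover have "(r - 1, m r) \<in> ?D" using mem(1) upd less.prems(4) by auto
      ultimately show ?thesis using sub' by (auto simp: active_cell_def)
    qed
    ultimately have "insert (r - 1 + 1, m r + 1) (?D - {(r - 1, m r)}) \<in> excited_diagrams lam mu"
      by (rule excited_diagrams.move)
    moreover have "insert (r - 1 + 1, m r + 1) (?D - {(r - 1, m r)}) =
        diagram lam - staircase (R hi) (R lo) m"
      using upd mem \<open>(r, m r + 1) \<in> diagram lam\<close> by auto
    ultimately show ?thesis by simp
  qed
qed

section \<open>The Kreiman path of a border strip\<close>

text \<open>No two strip cells share a diagonal, so every cell is the first on its own.\<close>

lemma kreiman_level_eq: "kreiman_level lam mu \<epsilon> = (if \<epsilon> = 0 then S else {})"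
proof (cases "\<epsilon> = 0")
  case True
  have "(i - 1, j - 1) \<notin> S" if "(i, j) \<in> S" for i j
    using no_diagonal[of "i - 1" "j - 1"] that S_subset by auto
  then show ?thesis using True by (auto simp: kreiman_level_def)
next
  case False
  have "(i - int \<epsilon>, j - int \<epsilon>) \<notin> S" if "(i, j) \<in> S" for i j
  proof
    assume "(i - int \<epsilon>, j - int \<epsilon>) \<in> S"
    then have "(i, j) = (i - int \<epsilon>, j - int \<epsilon>)"
      using that inj_onD[OF inj_on_content, of "(i, j)" "(i - int \<epsilon>, j - int \<epsilon>)"]
      by (simp add: content_def)
    then show False using False by simp
  qed
  then show ?thesis using False by (auto simp: kreiman_level_def)
qed

lemma kreiman_strips_eq: "kreiman_strips lam mu = [S]"
proof -
  have "(cell_adj S)\<^sup>* `` {u} = S" if u: "u \<in> S" for u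
  proof (intro equalityI subsetI)
    fix v assume "v \<in> (cell_adj S)\<^sup>* `` {u}"
    then have "(u, v) \<in> (cell_adj S)\<^sup>*" by simp
    then show "v \<in> S" by (cases rule: rtranclE) (use u in \<open>auto simp: cell_adj_def\<close>)
  next
    fix v assume "v \<in> S"
    then show "v \<in> (cell_adj S)\<^sup>* `` {u}"
      using u border_strip by (auto simp: border_strip_def cells_connected_def)
  qed
  then have "cell_components S = {S}"
    using nonempty by (auto simp: cell_components_def quotient_def)
  then have "cell_components (kreiman_level lam mu \<epsilon>) = (if \<epsilon> = 0 then {S} else {})" for \<epsilon>
    by (simp add: kreiman_level_eq cell_components_def quotient_def)
  then have comps: "(\<Union>\<epsilon>. cell_components (kreiman_level lam mu \<epsilon>)) = {S}" by simp
  show ?thesis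
    unfolding kreiman_strips_def comps by (rule sorted_key_list_of_set_singleton)
qed

lemma sw_most_S: "sw_most S = scell lo"
  unfolding sw_most_def
proof (rule the_equality)
  show *: "scell lo \<in> S \<and> (\<forall>v \<in> S. fst v \<le> R lo \<and> C lo \<le> snd v)"
  proof (intro conjI ballI)
    show "scell lo \<in> S" using scell_in(1)[of lo] lo_le_hi by simp
    fix v assume "v \<in> S"
    then obtain k where "lo \<le> k" "k \<le> hi" "v = scell k" by (rule S_cases)
    then show "fst v \<le> R lo" "C lo \<le> snd v" using scell_mono[of lo k] by simp_all
  qed
  show "u = scell lo" if "u \<in> S \<and> (\<forall>v \<in> S. fst v \<le> fst u \<and> snd u \<le> snd v)" for u
    using that * by (metis order_antisym prod_eq_iff)
qed

lemma ne_most_S: "ne_most S = scell hi"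
  unfolding ne_most_def
proof (rule the_equality)
  show *: "scell hi \<in> S \<and> (\<forall>v \<in> S. R hi \<le> fst v \<and> snd v \<le> C hi)"
  proof (intro conjI ballI)
    show "scell hi \<in> S" using scell_in(1)[of hi] lo_le_hi by simp
    fix v assume "v \<in> S"
    then obtain k where "lo \<le> k" "k \<le> hi" "v = scell k" by (rule S_cases)
    then show "R hi \<le> fst v" "snd v \<le> C hi" using scell_mono[of k hi] by simp_all
  qed
  show "u = scell hi" if "u \<in> S \<and> (\<forall>v \<in> S. fst u \<le> fst v \<and> snd v \<le> snd u)" for u
    using that * by (metis order_antisym prod_eq_iff)
qed

text \<open>A path is determined by its set of cells, which resolves the \<open>THE\<close>.\<close>

lemma kreiman_paths_eq:
  assumes "lattice_path p" "hd p = scell lo" "last p = scell hi" "set p = diagram lam - D"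
  shows "kreiman_paths lam mu D = [p]"
  unfolding kreiman_paths_def
proof (rule the_equality)
  show "kreiman_path_tuple lam mu D [p]"
    using assms by (auto simp: kreiman_path_tuple_def kreiman_strips_eq sw_most_S ne_most_S)
  fix ps assume ps: "kreiman_path_tuple lam mu D ps"
  then obtain q where "ps = [q]" "lattice_path q"
    by (auto simp: kreiman_path_tuple_def kreiman_strips_eq list_all2_Cons1)
  moreover from this have "set q = set p"
    using ps assms(4) by (simp add: kreiman_path_tuple_def)
  ultimately show "ps = [p]" using assms(1) lattice_path_eqI by blast
qed

lemma broken_diagonals_staircase:
  assumes "D = diagram lam - staircase (R hi) (R lo) m"
    and "m (R lo + 1) = C lo" "m (R hi) = C hi"
    and "\<And>r. R hi \<le> r \<Longrightarrow> r \<le> R lo \<Longrightarrow> m (r + 1) \<le> m r"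
    and "staircase (R hi) (R lo) m \<subseteq> diagram lam"
    and "u \<in> broken_diagonals lam mu D"
  shows "\<exists>r. R hi < r \<and> r \<le> R lo \<and> u = (r, m r)"
proof -
  have "R hi \<le> R lo" using scell_mono(1)[of lo hi] lo_le_hi by simp
  then obtain p where p: "lattice_path p" "hd p = (R lo, m (R lo + 1))" "last p = (R hi, m (R hi))"
      "set p = staircase (R hi) (R lo) m"
    using staircase_lattice_path[of "R hi" "R lo" m] assms(4) by blast
  have "kreiman_paths lam mu D = [p]"
    using p assms(1-3,5) by (intro kreiman_paths_eq) auto
  then obtain n where n: "Suc n < length p" "u = p ! n" "north_step (p ! n) (p ! Suc n)"
    using assms(6) by (auto simp: broken_diagonals_def)
  obtain r j where rj: "u = (r, j)" by (cases u)
  have "(r, j) \<in> staircase (R hi) (R lo) m" "(r - 1, j) \<in> staircase (R hi) (R lo) m"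
  proof -
    have pn: "p ! n = (r, j)" using n(2) rj by simp
    then have "p ! Suc n = (r - 1, j)" using n(3) by (simp add: north_step_def)
    with pn show "(r, j) \<in> staircase (R hi) (R lo) m" "(r - 1, j) \<in> staircase (R hi) (R lo) m"
      using nth_mem[of n p] nth_mem[of "Suc n" p] n(1) unfolding p(4) by simp_all
  qed
  \<comment> \<open>Membership in row \<open>r - 1\<close> gives \<open>m r \<le> j\<close>,
    membership in row \<open>r\<close> gives \<open>j \<le> m r\<close>.\<close>
  then have "R hi < r \<and> r \<le> R lo \<and> j = m r" unfolding staircase_def by simp
  then show ?thesis using rj by simp
qed

section \<open>The excited diagram determined by the array\<close>

lemma HG_ssyt_in_array_star:
  assumes "is_ssyt lam mu T"
  shows "\<exists>D \<in> excited_diagrams lam mu. HG lam (extend_by_zero S T) \<in> array_star lam mu D"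
proof -
  define A where "A = HG lam (extend_by_zero S T)"
  note entry = HG_ssyt(1)[OF assms, folded A_def]
    and chain = HG_ssyt(2)[OF assms, folded A_def]
    and row_hit = HG_ssyt(3)[OF assms, folded A_def]
  have entry_bounds: "R hi \<le> r \<and> r \<le> R lo \<and> C lo \<le> b \<and> b \<le> C hi \<and> b \<le> row_length r"
    if nz: "A (r, b) \<noteq> 0" for r b
  proof -
    obtain s e where se: "lo \<le> s" "s \<le> e" "e \<le> hi" "r = R e" "b = C s" using entry[OF nz] by blast
    have "R hi \<le> R e" "R e \<le> R lo" "C lo \<le> C s" "C s \<le> C e" "C e \<le> C hi"
      using scell_mono[of lo s] scell_mono[of s e] scell_mono[of lo e] scell_mono[of e hi] se
      by auto
    moreover have "C e \<le> row_length (R e)"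
      using scell_in_diagram[of e] se by (simp add: diagram_def case_prod_beta)
    ultimately show ?thesis using se by simp
  qed
  define B where "B r = {b. A (r, b) \<noteq> 0}" for r
  have finB: "finite (B r)" for r
  proof (rule finite_subset)
    show "B r \<subseteq> {C lo..C hi}"
    proof
      fix b assume "b \<in> B r"
      then have "A (r, b) \<noteq> 0" by (simp add: B_def)
      then show "b \<in> {C lo..C hi}" using entry_bounds[of r b] by simp
    qed
  qed simp
  have B_ne: "B r \<noteq> {}" if r: "R hi < r" "r \<le> R lo" for r
  proof -
    have "R hi \<le> r - 1" "r - 1 < R lo" using r by auto
    then obtain k where k: "lo \<le> k" "k < hi" "north k" "R k = r - 1 + 1"
      by (rule north_step_from_row)
    have "R k = r" using k(4) by simp
    then show ?thesis using row_hit[OF k(1-3)] unfolding B_def by blast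
  qed
  \<comment> \<open>Leaving each row at its last nonzero entry, except that the value at
    \<open>R lo + 1\<close> fixes the SW end and the top row runs on to the NE end.\<close>
  define m where "m r = (if r = R lo + 1 then C lo else if r = R hi then C hi else Max (B r))" for r
  have RC: "R hi \<le> R lo" "C lo \<le> C hi" using scell_mono[of lo hi] lo_le_hi by auto
  have m_lo: "m (R lo + 1) = C lo" and m_hi: "m (R hi) = C hi"
    using RC by (auto simp: m_def)
  have m_in: "A (r, m r) \<noteq> 0" if "R hi < r" "r \<le> R lo" for r
    using Max_in[OF finB B_ne[OF that]] that by (simp add: m_def B_def)
  have le_m: "b \<le> m r" if "A (r, b) \<noteq> 0" for r b
    using Max_ge[OF finB, of b r] entry_bounds[OF that] that by (auto simp: m_def B_def)
  have m_bounds: "C lo \<le> m r \<and> m r \<le> row_length r" if "R hi \<le> r" "r \<le> R lo" for r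
  proof (cases "r = R hi")
    case True
    then show ?thesis using m_hi row_end[of hi] lo_le_hi RC by simp
  next
    case False
    then show ?thesis using entry_bounds[OF m_in[of r]] that by simp
  qed
  have m_anti: "m (r + 1) \<le> m r" if rb: "R hi \<le> r" "r \<le> R lo" for r
  proof -
    consider "r = R lo" | "r < R lo" "r = R hi" | "r < R lo" "R hi < r" using rb by linarith
    then show ?thesis
    proof cases
      case 1
      then show ?thesis using m_lo m_bounds[OF rb] by simp
    next
      case 2
      then show ?thesis using entry_bounds[OF m_in[of "r + 1"]] m_hi by simp
    next
      case 3
      then show ?thesis using chain[OF m_in[of "r + 1"] m_in[of r]] by simp
    qed
  qed
  have m_ge: "C lo \<le> m (r + 1)" if "R hi \<le> r" "r \<le> R lo" for r
    using m_lo m_bounds[of "r + 1"] that by (cases "r = R lo") auto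
  have "1 \<le> C lo" using scell_in_diagram[of lo] lo_le_hi by (simp add: diagram_def case_prod_beta)
  have sub: "staircase (R hi) (R lo) m \<subseteq> diagram lam"
  proof
    fix u assume "u \<in> staircase (R hi) (R lo) m"
    then obtain r j where rj: "u = (r, j)" "R hi \<le> r" "r \<le> R lo" "m (r + 1) \<le> j" "j \<le> m r"
      by (auto simp: staircase_def)
    then show "u \<in> diagram lam"
      using rows[OF rj(2,3)] m_ge[OF rj(2,3)] m_bounds[OF rj(2,3)] \<open>1 \<le> C lo\<close> by simp
  qed
  define D where "D = diagram lam - staircase (R hi) (R lo) m"
  have "D \<in> excited_diagrams lam mu"
    unfolding D_def using m_lo m_hi m_anti sub by (rule staircase_complement_excited)
  moreover have "A \<in> array_star lam mu D"
  proof -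
    \<comment> \<open>The maximum bounds \<open>b\<close> from the right. From the left it is
      bounded by \<open>m (r + 1)\<close>, itself the column of an entry one row below, by the chain
      property.\<close>
    have "(r, b) \<in> diagram lam - D" if nz: "A (r, b) \<noteq> 0" for r b
    proof -
      have b: "R hi \<le> r" "r \<le> R lo" "C lo \<le> b" using entry_bounds[OF nz] by auto
      have "m (r + 1) \<le> b"
      proof (cases "r = R lo")
        case False
        then have "A (r + 1, m (r + 1)) \<noteq> 0" using m_in[of "r + 1"] b by simp
        then show ?thesis using chain[OF _ nz] by simp
      qed (use m_lo b in simp)
      then have "(r, b) \<in> staircase (R hi) (R lo) m"
        using b le_m[OF nz] by (simp add: staircase_def)
      then show ?thesis using sub by (auto simp: D_def)
    qed
    \<comment> \<open>Broken diagonals sit where the path leaves a row northwards, that is, at the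
      chosen nonzero entries.\<close>
    moreover have "A u > 0" if u: "u \<in> broken_diagonals lam mu D" for u
    proof -
      obtain r where "R hi < r" "r \<le> R lo" "u = (r, m r)"
        using broken_diagonals_staircase[OF D_def m_lo m_hi m_anti sub u] by blast
      then show ?thesis using m_in[of r] by simp
    qed
    ultimately have "{u. A u \<noteq> 0} \<subseteq> diagram lam - D" "\<forall>u \<in> broken_diagonals lam mu D. A u > 0"
      by fast+
    then show ?thesis by (simp add: array_star_def)
  qed
  ultimately show ?thesis unfolding A_def by blast
qed

end

section \<open>The empty skew shape and the conclusion\<close>

lemma HG_zero:
  assumes "\<forall>u \<in> diagram lam. \<pi> u = 0"
  shows "HG lam \<pi> = (\<lambda>_. 0)"
  unfolding HG_def using assms by (subst while_unfold) simp

text \<open>Without strips the only path tuple is the empty one.\<close>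

lemma broken_diagonals_empty_skew:
  assumes "skew_diagram lam mu = {}"
  shows "broken_diagonals lam mu (diagram lam) = {}"
proof -
  have "(\<Union>\<epsilon>. cell_components (kreiman_level lam mu \<epsilon>)) = {}"
    using assms by (simp add: kreiman_level_def cell_components_def)
  then have "kreiman_strips lam mu = []"
    by (simp add: kreiman_strips_def sorted_key_list_of_empty_set)
  then have "kreiman_path_tuple lam mu (diagram lam) ps \<longleftrightarrow> ps = []" for ps
    by (auto simp: kreiman_path_tuple_def)
  then have "kreiman_paths lam mu (diagram lam) = []"
    by (simp add: kreiman_paths_def)
  then show ?thesis by (simp add: broken_diagonals_def)
qed

theorem theorem7p1:
  fixes lam mu :: "nat list" and T :: "cell \<Rightarrow> nat"
  assumes "border_strip lam mu"
    and "is_ssyt lam mu T"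
  shows "\<exists>D \<in> excited_diagrams lam mu.
           HG lam (extend_by_zero (skew_diagram lam mu) T) \<in> array_star lam mu D"
proof (cases "skew_diagram lam mu = {}")
  case True
  \<comment> \<open>\<open>border_strip\<close> also admits \<open>lam\<close> and \<open>mu\<close>
    with equal diagrams. Then the zero array lies in the set for the full diagram.\<close>
  then have "diagram mu = diagram lam"
    using assms(1) by (auto simp: border_strip_def skew_shape_def skew_diagram_def)
  then have "diagram lam \<in> excited_diagrams lam mu"
    using excited_diagrams.base[of mu lam] by simp
  moreover have "HG lam (extend_by_zero (skew_diagram lam mu) T) = (\<lambda>_. 0)"
    using True by (intro HG_zero) (simp add: extend_by_zero_def)
  then have "HG lam (extend_by_zero (skew_diagram lam mu) T) \<in> array_star lam mu (diagram lam)"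
    using broken_diagonals_empty_skew[OF True] by (simp add: array_star_def)
  ultimately show ?thesis by blast
next
  case False
  then interpret nonempty_border_strip lam mu
    using assms(1) by unfold_locales
  show ?thesis using assms(2) by (rule HG_ssyt_in_array_star)
qed

end
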